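(* Let $\mathbf P=(P,\leq,{}',0,1)$ be an orthogonal poset and let $\mathbf L=(P,\sqcup,\sqcap,{}',0,1)$ be a $\lambda$-lattice assigned to $\mathbf P$. Then $\mathbf P$ is almost skew-orthomodular if and only if $\mathbf L$ satisfies the identity $$(((x\sqcap y)'\sqcap z)\sqcap(y\sqcap z))\sqcup((x\sqcap y)'\sqcap y)\approx(x\sqcap y)'\sqcap y .$$ Hence $\mathcal{L}a$, the class of all bounded $\lambda$-lattices $\mathbf L$ with a unary operation whose induced poset $\mathbb P(\mathbf L)$ is almost skew-orthomodular, is a variety.
   Context: A bounded poset with a unary operation is a structure $\mathbf P=(P,\leq,{}',0,1)$ where $(P,\leq)$ is a poset with least element $0$ and greatest element $1$ and ${}'$ is an arbitrary unary operation on $P$. For $a,b\in P$, $a\vee b$ denotes $\sup(a,b)$ and $a\wedge b$ denotes $\inf(a,b)$, whenever these exist; $U(a,b)=\{x\in P\mid a,b\leq x\}$ and $L(a,b)=\{x\in P\mid x\leq a,b\}$. $\mathbf P$ is complemented if for every $x\in P$ the elements $x\vee x'$ and $x\wedge x'$ exist with $x\vee x'=1$ and $x\wedge x'=0$. A complemented poset is orthogonal if $x\vee y$ exists for all $x,y\in P$ with $x\leq y'$. An orthogonal poset is almost skew-orthomodular if $x\vee(x'\wedge y)$ exists (i.e. $x'\wedge y$ exists and its join with $x$ exists) for all $x,y\in P$ with $x\leq y$. A bounded $\lambda$-lattice is an algebra $(L,\sqcup,\sqcap,0,1)$ of type $(2,2,0,0)$ satisfying the identities $x\sqcup y\approx y\sqcup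 x$, $x\sqcap y\approx y\sqcap x$, $x\sqcup((x\sqcup y)\sqcup z)\approx(x\sqcup y)\sqcup z$, $x\sqcap((x\sqcap y)\sqcap z)\approx(x\sqcap y)\sqcap z$, $x\sqcup(x\sqcap y)\approx x$, $x\sqcap(x\sqcup y)\approx x$, $x\sqcup0\approx x$, $x\sqcup1\approx1$. A bounded $\lambda$-lattice with a unary operation is an algebra $\mathbf L=(L,\sqcup,\sqcap,{}',0,1)$ such that $(L,\sqcup,\sqcap,0,1)$ is a bounded $\lambda$-lattice and ${}'$ is a unary operation on $L$. Its induced bounded poset with a unary operation is $\mathbb P(\mathbf L)=(L,\leq,{}',0,1)$, where $x\leq y$ if and only if $x\sqcup y=y$. A $\lambda$-lattice assigned to a bounded poset $\mathbf P=(P,\leq,{}',0,1)$ with a unary operation is any algebra $(P,\sqcup,\sqcap,{}',0,1)$ (with the same ${}',0,1$) such that for all $x,y\in P$: if $x\vee y$ exists then $x\sqcup y=x\vee y$, otherwise $x\sqcup y=y\sqcup x$ is an arbitrarily chosen element of $U(x,y)$; if $x\wedge y$ exists then $x\sqcap y=x\wedge y$, otherwise $x\sqcap y=y\sqcap x$ is an arbitrarily chosen element of $L(x,y)$. It is a bounded $\lambda$-lattice with a unary operation.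
   Formalization: The last sentence fails literally (the class is not closed under subalgebras); here La also requires, in P(L), that x⊔y=x∨y when x≤y′ and x∨y exists, and x′⊓y=x′∧y when x≤y and x′∧y exists, which is automatic if L is assigned to P(L). *)

theory Defs
  imports Main "HOL-Algebra.Order"
begin

text \<open>
  Posets follow \<^theory>\<open>HOL-Algebra.Order\<close>: \<open>s\<close> is the join of \<open>x\<close> and \<open>y\<close> in \<open>P\<close> iff
  \<^term>\<open>is_lub P s {x, y}\<close>, and the join exists iff there is such an \<open>s\<close>; dually for meets. The
  set of common upper bounds of \<open>x\<close> and \<open>y\<close> is \<^term>\<open>Upper P {x, y}\<close>.
\<close>

record 'a uposet = "'a gorder" +
  pcompl :: "'a \<Rightarrow> 'a"
  pzero :: 'a
  pone :: 'a

definition bounded_uposet :: "('a, 'm) uposet_scheme \<Rightarrow> bool" where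
  "bounded_uposet P \<longleftrightarrow>
     partial_order P \<and>
     least P (pzero P) (carrier P) \<and>
     greatest P (pone P) (carrier P) \<and>
     (\<forall>x\<in>carrier P. pcompl P x \<in> carrier P)"

definition complemented_poset :: "('a, 'm) uposet_scheme \<Rightarrow> bool" where
  "complemented_poset P \<longleftrightarrow>
     bounded_uposet P \<and>
     (\<forall>x\<in>carrier P. is_lub P (pone P) {x, pcompl P x} \<and> is_glb P (pzero P) {x, pcompl P x})"

definition orthogonal_poset :: "('a, 'm) uposet_scheme \<Rightarrow> bool" where
  "orthogonal_poset P \<longleftrightarrow>
     complemented_poset P \<and>
     (\<forall>x\<in>carrier P. \<forall>y\<in>carrier P. x \<sqsubseteq>\<^bsub>P\<^esub> pcompl P y \<longrightarrow> (\<exists>s. is_lub P s {x, y}))"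

definition almost_skew_orthomodular :: "('a, 'm) uposet_scheme \<Rightarrow> bool" where
  "almost_skew_orthomodular P \<longleftrightarrow>
     orthogonal_poset P \<and>
     (\<forall>x\<in>carrier P. \<forall>y\<in>carrier P. x \<sqsubseteq>\<^bsub>P\<^esub> y \<longrightarrow>
        (\<exists>m s. is_glb P m {pcompl P x, y} \<and> is_lub P s {x, m}))"

record 'a ualg = "'a partial_object" +
  join :: "'a \<Rightarrow> 'a \<Rightarrow> 'a" (infixl \<open>\<squnion>\<index>\<close> 65)
  meet :: "'a \<Rightarrow> 'a \<Rightarrow> 'a" (infixl \<open>\<sqinter>\<index>\<close> 70)
  compl :: "'a \<Rightarrow> 'a" (\<open>_\<^sup>\<bottom>\<index>\<close> [90] 90)
  zero :: 'a (\<open>\<zero>\<index>\<close>)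
  one :: 'a (\<open>\<one>\<index>\<close>)

definition algebra :: "('a, 'm) ualg_scheme \<Rightarrow> bool" where
  "algebra L \<longleftrightarrow>
     (\<forall>x\<in>carrier L. \<forall>y\<in>carrier L. x \<squnion>\<^bsub>L\<^esub> y \<in> carrier L \<and> x \<sqinter>\<^bsub>L\<^esub> y \<in> carrier L) \<and>
     (\<forall>x\<in>carrier L. x\<^sup>\<bottom>\<^bsub>L\<^esub> \<in> carrier L) \<and>
     \<zero>\<^bsub>L\<^esub> \<in> carrier L \<and> \<one>\<^bsub>L\<^esub> \<in> carrier L"

definition bounded_lambda_lattice :: "('a, 'm) ualg_scheme \<Rightarrow> bool" where
  "bounded_lambda_lattice L \<longleftrightarrow>
     algebra L \<and>
     (\<forall>x\<in>carrier L. \<forall>y\<in>carrier L. \<forall>z\<in>carrier L.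
        x \<squnion>\<^bsub>L\<^esub> y = y \<squnion>\<^bsub>L\<^esub> x \<and>
        x \<sqinter>\<^bsub>L\<^esub> y = y \<sqinter>\<^bsub>L\<^esub> x \<and>
        x \<squnion>\<^bsub>L\<^esub> ((x \<squnion>\<^bsub>L\<^esub> y) \<squnion>\<^bsub>L\<^esub> z) = (x \<squnion>\<^bsub>L\<^esub> y) \<squnion>\<^bsub>L\<^esub> z \<and>
        x \<sqinter>\<^bsub>L\<^esub> ((x \<sqinter>\<^bsub>L\<^esub> y) \<sqinter>\<^bsub>L\<^esub> z) = (x \<sqinter>\<^bsub>L\<^esub> y) \<sqinter>\<^bsub>L\<^esub> z \<and>
        x \<squnion>\<^bsub>L\<^esub> (x \<sqinter>\<^bsub>L\<^esub> y) = x \<and>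
        x \<sqinter>\<^bsub>L\<^esub> (x \<squnion>\<^bsub>L\<^esub> y) = x \<and>
        x \<squnion>\<^bsub>L\<^esub> \<zero>\<^bsub>L\<^esub> = x \<and>
        x \<squnion>\<^bsub>L\<^esub> \<one>\<^bsub>L\<^esub> = \<one>\<^bsub>L\<^esub>)"

definition induced_poset :: "('a, 'm) ualg_scheme \<Rightarrow> 'a uposet" where
  "induced_poset L =
     \<lparr>carrier = carrier L, eq = (=), le = (\<lambda>x y. x \<squnion>\<^bsub>L\<^esub> y = y),
      pcompl = compl L, pzero = \<zero>\<^bsub>L\<^esub>, pone = \<one>\<^bsub>L\<^esub>\<rparr>"

definition assigned_to :: "('a, 'm) ualg_scheme \<Rightarrow> ('a, 'n) uposet_scheme \<Rightarrow> bool" where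
  "assigned_to L P \<longleftrightarrow>
     carrier L = carrier P \<and>
     (\<forall>x\<in>carrier P. x\<^sup>\<bottom>\<^bsub>L\<^esub> = pcompl P x) \<and> \<zero>\<^bsub>L\<^esub> = pzero P \<and> \<one>\<^bsub>L\<^esub> = pone P \<and>
     (\<forall>x\<in>carrier P. \<forall>y\<in>carrier P.
        (if \<exists>s. is_lub P s {x, y} then is_lub P (x \<squnion>\<^bsub>L\<^esub> y) {x, y}
         else x \<squnion>\<^bsub>L\<^esub> y = y \<squnion>\<^bsub>L\<^esub> x \<and> x \<squnion>\<^bsub>L\<^esub> y \<in> Upper P {x, y}) \<and>
        (if \<exists>m. is_glb P m {x, y} then is_glb P (x \<sqinter>\<^bsub>L\<^esub> y) {x, y}
         else x \<sqinter>\<^bsub>L\<^esub> y = y \<sqinter>\<^bsub>L\<^esub> x \<and> x \<sqinter>\<^bsub>L\<^esub> y \<in> Lower P {x, y}))"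

datatype uterm =
    Var nat
  | Join uterm uterm
  | Meet uterm uterm
  | Compl uterm
  | Zero
  | One

primrec eval_term :: "('a, 'm) ualg_scheme \<Rightarrow> (nat \<Rightarrow> 'a) \<Rightarrow> uterm \<Rightarrow> 'a" where
  "eval_term L v (Var n) = v n"
| "eval_term L v (Join s t) = eval_term L v s \<squnion>\<^bsub>L\<^esub> eval_term L v t"
| "eval_term L v (Meet s t) = eval_term L v s \<sqinter>\<^bsub>L\<^esub> eval_term L v t"
| "eval_term L v (Compl s) = (eval_term L v s)\<^sup>\<bottom>\<^bsub>L\<^esub>"
| "eval_term L v Zero = \<zero>\<^bsub>L\<^esub>"
| "eval_term L v One = \<one>\<^bsub>L\<^esub>"

type_synonym identity = "uterm \<times> uterm"

definition satisfies :: "('a, 'm) ualg_scheme \<Rightarrow> identity \<Rightarrow> bool" where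
  "satisfies L e \<longleftrightarrow>
     (\<forall>v. range v \<subseteq> carrier L \<longrightarrow> eval_term L v (fst e) = eval_term L v (snd e))"

text \<open>
  A variety is the class of models of a set of identities. The identities do not depend on the type
  of the elements, so that one set of identities can be used for carriers in different types.
\<close>

definition equational_class :: "identity set \<Rightarrow> 'a ualg set" where
  "equational_class E = {L. algebra L \<and> (\<forall>e\<in>E. satisfies L e)}"

definition asom_identity :: identity where
  "asom_identity =
     (let x = Var 0; y = Var 1; z = Var 2; c = Compl (Meet x y)
      in (Join (Meet (Meet c z) (Meet y z)) (Meet c y), Meet c y))"

text \<open>
  The identities of a bounded \<open>\<lambda>\<close>-lattice only make \<open>x \<squnion> y\<close> an upper bound of \<open>x\<close> and \<open>y\<close> in
  the induced poset, even where a least upper bound exists. So the bounded \<open>\<lambda>\<close>-lattices whose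
  induced poset is almost skew-orthomodular, with no link between the operations and existing joins
  and meets, are not a variety: in the Boolean algebra with four atoms put \<open>x \<squnion> y = 1\<close> and
  \<open>x \<sqinter> y = 0\<close> for incomparable \<open>x\<close> and \<open>y\<close>; then \<open>0\<close>, \<open>1\<close>, the atoms and the coatoms form a
  subalgebra in which two distinct atoms are orthogonal and have no join. Requiring every
  existing join and meet to be given by \<open>\<squnion>\<close> and \<open>\<sqinter>\<close> is not preserved by subalgebras either.

  The class \<open>La\<close> below requires this agreement exactly at the pairs at which the definition of an
  almost skew-orthomodular poset asks for a join or meet (for \<open>x\<close> and \<open>x'\<close> it is automatic). For
  \<open>\<lambda>\<close>-lattices assigned to their induced poset it is no restriction; see \<open>La_iff_if_assigned\<close>.
\<close>

definition agrees_with_poset :: "('a, 'm) ualg_scheme \<Rightarrow> ('a, 'n) uposet_scheme \<Rightarrow> bool" where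
  "agrees_with_poset L P \<longleftrightarrow>
     (\<forall>x\<in>carrier P. \<forall>y\<in>carrier P. \<forall>s.
        x \<sqsubseteq>\<^bsub>P\<^esub> pcompl P y \<and> is_lub P s {x, y} \<longrightarrow> x \<squnion>\<^bsub>L\<^esub> y = s) \<and>
     (\<forall>x\<in>carrier P. \<forall>y\<in>carrier P. \<forall>m.
        x \<sqsubseteq>\<^bsub>P\<^esub> y \<and> is_glb P m {pcompl P x, y} \<longrightarrow> x\<^sup>\<bottom>\<^bsub>L\<^esub> \<sqinter>\<^bsub>L\<^esub> y = m)"

definition La :: "'a ualg set" where
  "La = {L. bounded_lambda_lattice L \<and> agrees_with_poset L (induced_poset L) \<and>
            almost_skew_orthomodular (induced_poset L)}"

lemma agrees_with_poset_if_assigned: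
  assumes "assigned_to L P" "bounded_uposet P"
  shows "agrees_with_poset L P"
proof -
  interpret partial_order P
    using assms(2) by (simp add: bounded_uposet_def)
  show ?thesis
    using assms
    unfolding agrees_with_poset_def assigned_to_def bounded_uposet_def
    by (metis least_unique greatest_unique)
qed

lemma La_iff_if_assigned:
  assumes "bounded_lambda_lattice L" "assigned_to L (induced_poset L)"
  shows "L \<in> La \<longleftrightarrow> almost_skew_orthomodular (induced_poset L)"
  using assms agrees_with_poset_if_assigned[of L "induced_poset L"]
  by (auto simp: La_def almost_skew_orthomodular_def orthogonal_poset_def complemented_poset_def)

end

theory Submission
  imports Defs
begin

text \<open>
  Over a poset, an operation \<open>\<squnion>\<close> that picks upper bounds and fixes comparable pairs turns
  quantification over the upper bounds of \<open>x\<close> and \<open>y\<close> into terms: \<open>(x \<squnion> z) \<squnion> (y \<squnion> z)\<close> is always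
  an upper bound of both, and it equals \<open>z\<close> as soon as \<open>z\<close> is one; dually for \<open>\<sqinter>\<close>. Similarly,
  \<open>x \<sqinter> y\<close> ranges over all elements below \<open>y\<close>. So a universally quantified statement ``if \<open>x \<le> y\<close>,
  then a given term is the join (or meet) of two others'' is an identity. Complementation,
  orthogonality and the existence of \<open>x' \<and> y\<close> for \<open>x \<le> y\<close> all have this form, and orthogonality
  supplies the remaining join, because \<open>x' \<and> y \<le> x'\<close>.
\<close>

section \<open>Evaluating terms in three variables\<close>

primrec vars :: "uterm \<Rightarrow> nat set" where
  "vars (Var n) = {n}"
| "vars (Join s t) = vars s \<union> vars t"
| "vars (Meet s t) = vars s \<union> vars t"
| "vars (Compl s) = vars s"
| "vars Zero = {}"
| "vars One = {}"

lemma eval_term_cong: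
  "(\<And>n. n \<in> vars t \<Longrightarrow> v n = w n) \<Longrightarrow> eval_term L v t = eval_term L w t"
  by (induction t) auto

text \<open>All indices from 2 on carry \<open>z\<close>: valuations are total, so the remaining
  variables need a value in the carrier as well.\<close>

definition triple :: "'a \<Rightarrow> 'a \<Rightarrow> 'a \<Rightarrow> nat \<Rightarrow> 'a" where
  "triple x y z = (\<lambda>_. z)(0 := x, 1 := y)"

lemma triple_simps [simp]:
  "triple x y z 0 = x" "triple x y z (Suc 0) = y" "triple x y z 2 = z"
  by (simp_all add: triple_def)

text \<open>The value of a term depends only on the variables in it, so quantifying over valuations
  reduces to quantifying over three elements.\<close>

lemma satisfies_iff_triple:
  assumes "vars s \<union> vars t \<subseteq> {0, 1, 2}"
  shows "satisfies L (s, t) \<longleftrightarrow>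
    (\<forall>x\<in>carrier L. \<forall>y\<in>carrier L. \<forall>z\<in>carrier L.
       eval_term L (triple x y z) s = eval_term L (triple x y z) t)"
proof
  assume "satisfies L (s, t)"
  moreover have "range (triple x y z) \<subseteq> carrier L"
    if "x \<in> carrier L" "y \<in> carrier L" "z \<in> carrier L" for x y z
    using that by (auto simp: triple_def)
  ultimately show "\<forall>x\<in>carrier L. \<forall>y\<in>carrier L. \<forall>z\<in>carrier L.
       eval_term L (triple x y z) s = eval_term L (triple x y z) t"
    by (simp add: satisfies_def)
next
  assume *: "\<forall>x\<in>carrier L. \<forall>y\<in>carrier L. \<forall>z\<in>carrier L.
       eval_term L (triple x y z) s = eval_term L (triple x y z) t"
  have "eval_term L v s = eval_term L v t" if "range v \<subseteq> carrier L" for v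
  proof -
    have "eval_term L v u = eval_term L (triple (v 0) (v 1) (v 2)) u"
      if "vars u \<subseteq> {0, 1, 2}" for u
      using that by (intro eval_term_cong) auto
    moreover have "v 0 \<in> carrier L" "v 1 \<in> carrier L" "v 2 \<in> carrier L"
      using that by auto
    ultimately show ?thesis
      using * assms by simp
  qed
  then show "satisfies L (s, t)"
    by (simp add: satisfies_def)
qed

section \<open>The identities that define the variety\<close>

definition lambda_identities :: "identity set" where
  "lambda_identities =
     (let x = Var 0; y = Var 1; z = Var 2
      in {(Join x y, Join y x),
          (Meet x y, Meet y x),
          (Join x (Join (Join x y) z), Join (Join x y) z),
          (Meet x (Meet (Meet x y) z), Meet (Meet x y) z),
          (Join x (Meet x y), x),
          (Meet x (Join x y), x),
          (Join x Zero, x),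
          (Join x One, One)})"

text \<open>The left side runs through all common upper bounds of \<open>x\<close> and
  \<open>x'\<close>, so the only one is 1. The plain identity \<open>x \<squnion> x' = 1\<close>
  would say less, because \<open>\<squnion>\<close> may pick an upper bound that is not the
  least.\<close>

definition join_compl_identity :: identity where
  "join_compl_identity =
     (Join (Join (Var 0) (Var 2)) (Join (Compl (Var 0)) (Var 2)), One)"

definition meet_compl_identity :: identity where
  "meet_compl_identity =
     (Meet (Meet (Var 0) (Var 2)) (Meet (Compl (Var 0)) (Var 2)), Zero)"

text \<open>Here \<open>d\<close> stands for an arbitrary element below \<open>y'\<close> and
  \<open>u\<close> for an arbitrary common upper bound of \<open>d\<close> and \<open>y\<close>. The
  equation expresses \<open>d \<squnion> y \<le> u\<close>.\<close>

definition orthogonality_identity :: identity where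
  "orthogonality_identity =
     (let y = Var 1; z = Var 2; d = Meet (Var 0) (Compl y); u = Join (Join d z) (Join y z)
      in (Join (Join d y) u, u))"

lemma bounded_lambda_lattice_iff_identities:
  "bounded_lambda_lattice L \<longleftrightarrow> algebra L \<and> (\<forall>e\<in>lambda_identities. satisfies L e)"
  unfolding bounded_lambda_lattice_def lambda_identities_def Let_def
  by (simp add: satisfies_iff_triple ball_conj_distrib) blast

section \<open>Operations that pick bounds in a poset\<close>

text \<open>Common ground of two situations: \<open>L\<close> is assigned to \<open>P\<close>, or
  \<open>P\<close> is induced by the bounded \<lambda>-lattice \<open>L\<close>. Commutativity is
  replaced by absorption of comparable pairs, in both orders for \<open>\<sqinter>\<close>.\<close>

locale uposet_operations = partial_order P
  for P :: "('a, 'm) uposet_scheme" (structure) +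
  fixes L :: "('a, 'n) ualg_scheme"
  assumes bounded: "bounded_uposet P"
    and carrier_eq: "carrier L = carrier P"
    and compl_eq: "x \<in> carrier P \<Longrightarrow> x\<^sup>\<bottom>\<^bsub>L\<^esub> = pcompl P x"
    and zero_eq: "\<zero>\<^bsub>L\<^esub> = pzero P"
    and one_eq: "\<one>\<^bsub>L\<^esub> = pone P"
    and join_upper: "\<lbrakk>x \<in> carrier P; y \<in> carrier P\<rbrakk> \<Longrightarrow> x \<squnion>\<^bsub>L\<^esub> y \<in> Upper P {x, y}"
    and meet_lower: "\<lbrakk>x \<in> carrier P; y \<in> carrier P\<rbrakk> \<Longrightarrow> x \<sqinter>\<^bsub>L\<^esub> y \<in> Lower P {x, y}"
    and join_absorb: "\<lbrakk>x \<in> carrier P; y \<in> carrier P; x \<sqsubseteq> y\<rbrakk> \<Longrightarrow> x \<squnion>\<^bsub>L\<^esub> y = y"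
    and meet_absorb: "\<lbrakk>x \<in> carrier P; y \<in> carrier P; x \<sqsubseteq> y\<rbrakk> \<Longrightarrow> x \<sqinter>\<^bsub>L\<^esub> y = x"
    and meet_absorb2: "\<lbrakk>x \<in> carrier P; y \<in> carrier P; x \<sqsubseteq> y\<rbrakk> \<Longrightarrow> y \<sqinter>\<^bsub>L\<^esub> x = x"
begin

lemma is_lub_pair:
  assumes "x \<in> carrier P" "y \<in> carrier P"
  shows "is_lub P s {x, y} \<longleftrightarrow>
    s \<in> carrier P \<and> x \<sqsubseteq> s \<and> y \<sqsubseteq> s \<and> (\<forall>u\<in>carrier P. x \<sqsubseteq> u \<and> y \<sqsubseteq> u \<longrightarrow> s \<sqsubseteq> u)"
  using assms by (auto simp: least_def Upper_def)

lemma is_glb_pair: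
  assumes "x \<in> carrier P" "y \<in> carrier P"
  shows "is_glb P m {x, y} \<longleftrightarrow>
    m \<in> carrier P \<and> m \<sqsubseteq> x \<and> m \<sqsubseteq> y \<and> (\<forall>u\<in>carrier P. u \<sqsubseteq> x \<and> u \<sqsubseteq> y \<longrightarrow> u \<sqsubseteq> m)"
  using assms by (auto simp: greatest_def Lower_def)

lemma closed [simp]:
  "x \<in> carrier P \<Longrightarrow> pcompl P x \<in> carrier P"
  "pzero P \<in> carrier P" "pone P \<in> carrier P"
  "\<lbrakk>x \<in> carrier P; y \<in> carrier P\<rbrakk> \<Longrightarrow> x \<squnion>\<^bsub>L\<^esub> y \<in> carrier P"
  "\<lbrakk>x \<in> carrier P; y \<in> carrier P\<rbrakk> \<Longrightarrow> x \<sqinter>\<^bsub>L\<^esub> y \<in> carrier P"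
  using bounded join_upper[of x y] meet_lower[of x y]
  by (auto simp: bounded_uposet_def least_def greatest_def Upper_def Lower_def)

lemma join_ge:
  assumes "x \<in> carrier P" "y \<in> carrier P"
  shows "x \<sqsubseteq> x \<squnion>\<^bsub>L\<^esub> y" "y \<sqsubseteq> x \<squnion>\<^bsub>L\<^esub> y"
  using assms join_upper[of x y] by (auto simp: Upper_def)

lemma meet_le:
  assumes "x \<in> carrier P" "y \<in> carrier P"
  shows "x \<sqinter>\<^bsub>L\<^esub> y \<sqsubseteq> x" "x \<sqinter>\<^bsub>L\<^esub> y \<sqsubseteq> y"
  using assms meet_lower[of x y] by (auto simp: Lower_def)

lemma le_iff_join: "\<lbrakk>x \<in> carrier P; y \<in> carrier P\<rbrakk> \<Longrightarrow> x \<sqsubseteq> y \<longleftrightarrow> x \<squnion>\<^bsub>L\<^esub> y = y"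
  using join_absorb join_ge(1) by metis

lemma join_join_ge:
  assumes "x \<in> carrier P" "y \<in> carrier P" "z \<in> carrier P"
  shows "x \<sqsubseteq> (x \<squnion>\<^bsub>L\<^esub> z) \<squnion>\<^bsub>L\<^esub> (y \<squnion>\<^bsub>L\<^esub> z)" "y \<sqsubseteq> (x \<squnion>\<^bsub>L\<^esub> z) \<squnion>\<^bsub>L\<^esub> (y \<squnion>\<^bsub>L\<^esub> z)"
  using assms by (meson closed join_ge le_trans)+

lemma meet_meet_le:
  assumes "x \<in> carrier P" "y \<in> carrier P" "z \<in> carrier P"
  shows "(x \<sqinter>\<^bsub>L\<^esub> z) \<sqinter>\<^bsub>L\<^esub> (y \<sqinter>\<^bsub>L\<^esub> z) \<sqsubseteq> x" "(x \<sqinter>\<^bsub>L\<^esub> z) \<sqinter>\<^bsub>L\<^esub> (y \<sqinter>\<^bsub>L\<^esub> z) \<sqsubseteq> y"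
  using assms by (meson closed meet_le le_trans)+

lemma join_join_absorb:
  assumes "x \<in> carrier P" "y \<in> carrier P" "z \<in> carrier P" "x \<sqsubseteq> z" "y \<sqsubseteq> z"
  shows "(x \<squnion>\<^bsub>L\<^esub> z) \<squnion>\<^bsub>L\<^esub> (y \<squnion>\<^bsub>L\<^esub> z) = z"
  using assms by (simp add: join_absorb)

lemma meet_meet_absorb:
  assumes "x \<in> carrier P" "y \<in> carrier P" "z \<in> carrier P" "z \<sqsubseteq> x" "z \<sqsubseteq> y"
  shows "(x \<sqinter>\<^bsub>L\<^esub> z) \<sqinter>\<^bsub>L\<^esub> (y \<sqinter>\<^bsub>L\<^esub> z) = z"
  using assms by (simp add: meet_absorb meet_absorb2)

text \<open>By \<open>join_join_ge\<close> and \<open>join_join_absorb\<close>, the values of the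
  term for varying \<open>z\<close> are exactly the common upper bounds. Leastness thus becomes a
  statement about all \<open>z\<close>.\<close>

lemma is_lub_iff_join_join:
  assumes "x \<in> carrier P" "y \<in> carrier P" "s \<in> carrier P" "x \<sqsubseteq> s" "y \<sqsubseteq> s"
  shows "is_lub P s {x, y} \<longleftrightarrow>
    (\<forall>z\<in>carrier P. s \<sqsubseteq> (x \<squnion>\<^bsub>L\<^esub> z) \<squnion>\<^bsub>L\<^esub> (y \<squnion>\<^bsub>L\<^esub> z))"
  using assms join_join_ge join_join_absorb unfolding is_lub_pair[OF assms(1,2)]
  by (metis closed(4))

lemma is_glb_iff_meet_meet:
  assumes "x \<in> carrier P" "y \<in> carrier P" "m \<in> carrier P" "m \<sqsubseteq> x" "m \<sqsubseteq> y"
  shows "is_glb P m {x, y} \<longleftrightarrow>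
    (\<forall>z\<in>carrier P. (x \<sqinter>\<^bsub>L\<^esub> z) \<sqinter>\<^bsub>L\<^esub> (y \<sqinter>\<^bsub>L\<^esub> z) \<sqsubseteq> m)"
  using assms meet_meet_le meet_meet_absorb unfolding is_glb_pair[OF assms(1,2)]
  by (metis closed(5))

text \<open>The elements \<open>x \<sqinter> y\<close> are exactly those below \<open>y\<close>.
  This removes the premise \<open>x \<le> y\<close>, which an identity cannot contain.\<close>

lemma ball_below_iff_meet:
  assumes "y \<in> carrier P"
  shows "(\<forall>x\<in>carrier P. x \<sqsubseteq> y \<longrightarrow> Q x) \<longleftrightarrow> (\<forall>x\<in>carrier P. Q (x \<sqinter>\<^bsub>L\<^esub> y))"
  using assms by (metis closed(5) meet_absorb meet_le(2))

lemma pzero_le: "x \<in> carrier P \<Longrightarrow> pzero P \<sqsubseteq> x"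
  and pone_ge: "x \<in> carrier P \<Longrightarrow> x \<sqsubseteq> pone P"
  using bounded by (auto simp: bounded_uposet_def least_def greatest_def)

section \<open>What the identities say about the poset\<close>

lemma satisfies_join_compl_iff:
  "satisfies L join_compl_identity \<longleftrightarrow> (\<forall>x\<in>carrier P. is_lub P (pone P) {x, pcompl P x})"
proof -
  have "is_lub P (pone P) {x, pcompl P x} \<longleftrightarrow>
      (\<forall>z\<in>carrier P. (x \<squnion>\<^bsub>L\<^esub> z) \<squnion>\<^bsub>L\<^esub> (pcompl P x \<squnion>\<^bsub>L\<^esub> z) = pone P)" if "x \<in> carrier P" for x
    unfolding is_lub_iff_join_join[OF that closed(1)[OF that] closed(3)
        pone_ge[OF that] pone_ge[OF closed(1)[OF that]]]
    \<comment> \<open>Since 1 is greatest, \<open>1 \<le> t\<close> is the same as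
      \<open>t = 1\<close>.\<close>
    using that by (metis closed(1,3,4) pone_ge le_antisym le_refl)
  then show ?thesis
    by (auto simp: join_compl_identity_def satisfies_iff_triple carrier_eq compl_eq one_eq)
qed

lemma satisfies_meet_compl_iff:
  "satisfies L meet_compl_identity \<longleftrightarrow> (\<forall>x\<in>carrier P. is_glb P (pzero P) {x, pcompl P x})"
proof -
  have "is_glb P (pzero P) {x, pcompl P x} \<longleftrightarrow>
      (\<forall>z\<in>carrier P. (x \<sqinter>\<^bsub>L\<^esub> z) \<sqinter>\<^bsub>L\<^esub> (pcompl P x \<sqinter>\<^bsub>L\<^esub> z) = pzero P)" if "x \<in> carrier P" for x
    unfolding is_glb_iff_meet_meet[OF that closed(1)[OF that] closed(2)
        pzero_le[OF that] pzero_le[OF closed(1)[OF that]]]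
    using that by (metis closed(1,2,5) pzero_le le_antisym le_refl)
  then show ?thesis
    by (auto simp: meet_compl_identity_def satisfies_iff_triple carrier_eq compl_eq zero_eq)
qed

lemma satisfies_orthogonality_iff:
  "satisfies L orthogonality_identity \<longleftrightarrow>
    (\<forall>x\<in>carrier P. \<forall>y\<in>carrier P. x \<sqsubseteq> pcompl P y \<longrightarrow> is_lub P (x \<squnion>\<^bsub>L\<^esub> y) {x, y})"
proof -
  \<comment> \<open>With \<open>y\<close> fixed, the bound \<open>y'\<close> is fixed too, so
    \<open>x\<close> can be replaced by \<open>x \<sqinter> y'\<close>; \<open>le_iff_join\<close>
    then turns the inequality into the equation.\<close>
  have "(\<forall>x\<in>carrier P. x \<sqsubseteq> pcompl P y \<longrightarrow> is_lub P (x \<squnion>\<^bsub>L\<^esub> y) {x, y}) \<longleftrightarrow>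
      (\<forall>x\<in>carrier P. let d = x \<sqinter>\<^bsub>L\<^esub> pcompl P y in \<forall>z\<in>carrier P.
         (d \<squnion>\<^bsub>L\<^esub> y) \<squnion>\<^bsub>L\<^esub> ((d \<squnion>\<^bsub>L\<^esub> z) \<squnion>\<^bsub>L\<^esub> (y \<squnion>\<^bsub>L\<^esub> z)) = (d \<squnion>\<^bsub>L\<^esub> z) \<squnion>\<^bsub>L\<^esub> (y \<squnion>\<^bsub>L\<^esub> z))"
    if "y \<in> carrier P" for y
    using that
    by (simp add: ball_below_iff_meet is_lub_iff_join_join join_ge le_iff_join[symmetric] Let_def)
  then show ?thesis
    by (auto simp: orthogonality_identity_def Let_def satisfies_iff_triple carrier_eq compl_eq)
qed

text \<open>The element \<open>x \<sqinter> y\<close> of the identity plays the role of an arbitrary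
  \<open>x \<le> y\<close>, and the left argument of the outer join that of an arbitrary lower bound
  of \<open>x'\<close> and \<open>y\<close>.\<close>

lemma satisfies_asom_iff:
  "satisfies L asom_identity \<longleftrightarrow>
    (\<forall>x\<in>carrier P. \<forall>y\<in>carrier P. x \<sqsubseteq> y \<longrightarrow>
       is_glb P (pcompl P x \<sqinter>\<^bsub>L\<^esub> y) {pcompl P x, y})"
proof -
  have "(\<forall>x\<in>carrier P. x \<sqsubseteq> y \<longrightarrow> is_glb P (pcompl P x \<sqinter>\<^bsub>L\<^esub> y) {pcompl P x, y}) \<longleftrightarrow>
      (\<forall>x\<in>carrier P. let c = pcompl P (x \<sqinter>\<^bsub>L\<^esub> y) in \<forall>z\<in>carrier P.
         ((c \<sqinter>\<^bsub>L\<^esub> z) \<sqinter>\<^bsub>L\<^esub> (y \<sqinter>\<^bsub>L\<^esub> z)) \<squnion>\<^bsub>L\<^esub> (c \<sqinter>\<^bsub>L\<^esub> y) = c \<sqinter>\<^bsub>L\<^esub> y)"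
    if "y \<in> carrier P" for y
    using that
    by (simp add: ball_below_iff_meet is_glb_iff_meet_meet meet_le le_iff_join[symmetric] Let_def)
  then show ?thesis
    by (auto simp: asom_identity_def Let_def satisfies_iff_triple carrier_eq compl_eq)
qed

lemma almost_skew_orthomodular_iff_meets:
  assumes "orthogonal_poset P"
  shows "almost_skew_orthomodular P \<longleftrightarrow>
    (\<forall>x\<in>carrier P. \<forall>y\<in>carrier P. x \<sqsubseteq> y \<longrightarrow> (\<exists>m. is_glb P m {pcompl P x, y}))"
proof -
  have "\<exists>s. is_lub P s {x, m}"
    if "x \<in> carrier P" "y \<in> carrier P" "is_glb P m {pcompl P x, y}" for x y m
  proof -
    have "m \<in> carrier P" "m \<sqsubseteq> pcompl P x"
      using that by (simp_all add: is_glb_pair)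
    \<comment> \<open>Orthogonality applies to the pair in this order, because
      \<open>m \<le> x'\<close>.\<close>
    then have "\<exists>s. is_lub P s {m, x}"
      using assms that(1) by (simp add: orthogonal_poset_def)
    then show ?thesis
      by (simp add: insert_commute)
  qed
  then show ?thesis
    using assms unfolding almost_skew_orthomodular_def by blast
qed

text \<open>Bounds are unique, so agreement means that the operation yields the bound whenever one
  exists. This form matches the characterisations of the identities.\<close>

lemma agrees_with_poset_iff:
  "agrees_with_poset L P \<longleftrightarrow>
    (\<forall>x\<in>carrier P. \<forall>y\<in>carrier P. x \<sqsubseteq> pcompl P y \<and> (\<exists>s. is_lub P s {x, y}) \<longrightarrow>
       is_lub P (x \<squnion>\<^bsub>L\<^esub> y) {x, y}) \<and>
    (\<forall>x\<in>carrier P. \<forall>y\<in>carrier P. x \<sqsubseteq> y \<and> (\<exists>m. is_glb P m {pcompl P x, y}) \<longrightarrow>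
       is_glb P (pcompl P x \<sqinter>\<^bsub>L\<^esub> y) {pcompl P x, y})"
proof -
  have "(\<forall>s. is_lub P s A \<longrightarrow> j = s) \<longleftrightarrow> ((\<exists>s. is_lub P s A) \<longrightarrow> is_lub P j A)"
    "(\<forall>m. is_glb P m A \<longrightarrow> j = m) \<longleftrightarrow> ((\<exists>m. is_glb P m A) \<longrightarrow> is_glb P j A)" for j A
    using least_unique greatest_unique by blast+
  then show ?thesis
    unfolding agrees_with_poset_def by (simp add: compl_eq imp_conjL)
qed

lemma almost_skew_orthomodular_iff_satisfies:
  assumes "orthogonal_poset P" "agrees_with_poset L P"
  shows "almost_skew_orthomodular P \<longleftrightarrow> satisfies L asom_identity"
proof -
  have "(\<exists>m. is_glb P m {pcompl P x, y}) \<longleftrightarrow> is_glb P (pcompl P x \<sqinter>\<^bsub>L\<^esub> y) {pcompl P x, y}"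
    if "x \<in> carrier P" "y \<in> carrier P" "x \<sqsubseteq> y" for x y
    using conjunct2[OF assms(2)[unfolded agrees_with_poset_iff]] that by blast
  then show ?thesis
    unfolding almost_skew_orthomodular_iff_meets[OF assms(1)] satisfies_asom_iff
    by (intro ball_cong imp_cong refl) blast+
qed

text \<open>The orthogonality identity and \<open>asom_identity\<close> assert existence and
  agreement at once: they make the value of the operation itself the join or meet.\<close>

lemma agrees_almost_skew_orthomodular_iff_identities:
  "agrees_with_poset L P \<and> almost_skew_orthomodular P \<longleftrightarrow>
    (\<forall>e\<in>{join_compl_identity, meet_compl_identity, orthogonality_identity, asom_identity}.
       satisfies L e)"
proof -
  \<comment> \<open>Agreement does not enter here, as the required bounds are the constants 0 and
    1.\<close>
  have complemented: "complemented_poset P \<longleftrightarrow>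
      satisfies L join_compl_identity \<and> satisfies L meet_compl_identity"
    using bounded
    by (auto simp: complemented_poset_def satisfies_join_compl_iff satisfies_meet_compl_iff)
  have orthogonal: "agrees_with_poset L P \<and> orthogonal_poset P \<Longrightarrow>
      satisfies L orthogonality_identity"
    unfolding agrees_with_poset_iff orthogonal_poset_def satisfies_orthogonality_iff by blast
  have "orthogonal_poset P"
    if "complemented_poset P" "satisfies L orthogonality_identity"
    using that unfolding orthogonal_poset_def satisfies_orthogonality_iff by blast
  moreover have "agrees_with_poset L P"
    if "satisfies L orthogonality_identity" "satisfies L asom_identity"
    using that unfolding agrees_with_poset_iff satisfies_orthogonality_iff satisfies_asom_iff
    by blast
  moreover have "complemented_poset P \<and> orthogonal_poset P" if "almost_skew_orthomodular P"
    using that by (simp add: almost_skew_orthomodular_def orthogonal_poset_def)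
  ultimately show ?thesis
    using complemented orthogonal almost_skew_orthomodular_iff_satisfies
    unfolding ball_simps by blast
qed

end

section \<open>The two sources of such operations\<close>

lemma uposet_operations_if_assigned:
  assumes "assigned_to L P" "bounded_uposet P"
  shows "uposet_operations P L"
proof -
  interpret partial_order P
    using assms(2) by (simp add: bounded_uposet_def)
  have join: "x \<squnion>\<^bsub>L\<^esub> y \<in> Upper P {x, y}"
    and meet: "x \<sqinter>\<^bsub>L\<^esub> y \<in> Lower P {x, y}"
    and lub: "is_lub P s {x, y} \<Longrightarrow> x \<squnion>\<^bsub>L\<^esub> y = s"
    and glb: "is_glb P s {x, y} \<Longrightarrow> x \<sqinter>\<^bsub>L\<^esub> y = s"
    if "x \<in> carrier P" "y \<in> carrier P" for x y s
    using assms(1) that unfolding assigned_to_def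
    by (metis least_mem greatest_mem least_unique greatest_unique)+
  \<comment> \<open>Comparable elements have a join and a meet, which leaves no choice to the
    operations and gives absorption.\<close>
  have "is_lub P y {x, y}" "is_glb P x {x, y}" "is_glb P x {y, x}"
    if "x \<in> carrier P" "y \<in> carrier P" "x \<sqsubseteq>\<^bsub>P\<^esub> y" for x y
    using that by (auto simp: least_def greatest_def Upper_def Lower_def)
  then show ?thesis
    using assms join meet lub glb
    by unfold_locales (auto simp: assigned_to_def)
qed

lemma uposet_operations_induced_poset:
  assumes "bounded_lambda_lattice L"
  shows "uposet_operations (induced_poset L) L"
proof -
  let ?P = "induced_poset L"
  have closed: "x \<squnion>\<^bsub>L\<^esub> y \<in> carrier L" "x \<sqinter>\<^bsub>L\<^esub> y \<in> carrier L" "x\<^sup>\<bottom>\<^bsub>L\<^esub> \<in> carrier L"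
    "\<zero>\<^bsub>L\<^esub> \<in> carrier L" "\<one>\<^bsub>L\<^esub> \<in> carrier L"
    if "x \<in> carrier L" "y \<in> carrier L" for x y
    using assms that by (auto simp: bounded_lambda_lattice_def algebra_def)
  have L: "x \<squnion>\<^bsub>L\<^esub> y = y \<squnion>\<^bsub>L\<^esub> x" "x \<sqinter>\<^bsub>L\<^esub> y = y \<sqinter>\<^bsub>L\<^esub> x"
    "x \<squnion>\<^bsub>L\<^esub> ((x \<squnion>\<^bsub>L\<^esub> y) \<squnion>\<^bsub>L\<^esub> z) = (x \<squnion>\<^bsub>L\<^esub> y) \<squnion>\<^bsub>L\<^esub> z"
    "x \<squnion>\<^bsub>L\<^esub> (x \<sqinter>\<^bsub>L\<^esub> y) = x" "x \<sqinter>\<^bsub>L\<^esub> (x \<squnion>\<^bsub>L\<^esub> y) = x"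
    "x \<squnion>\<^bsub>L\<^esub> \<zero>\<^bsub>L\<^esub> = x" "x \<squnion>\<^bsub>L\<^esub> \<one>\<^bsub>L\<^esub> = \<one>\<^bsub>L\<^esub>"
    if "x \<in> carrier L" "y \<in> carrier L" "z \<in> carrier L" for x y z
    using assms that unfolding bounded_lambda_lattice_def by blast+
  \<comment> \<open>Absorption twice: \<open>x = x \<squnion> (x \<sqinter> (x \<squnion> x)) = x
    \<squnion> x\<close>.\<close>
  have refl: "x \<squnion>\<^bsub>L\<^esub> x = x" if "x \<in> carrier L" for x
    using L(4,5) closed(1) that by metis
  \<comment> \<open>Weak associativity with \<open>x \<squnion> y\<close> replaced by
    \<open>y\<close>, and then \<open>y \<squnion> z\<close> by \<open>z\<close>.\<close>
  have trans: "x \<squnion>\<^bsub>L\<^esub> z = z"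
    if "x \<squnion>\<^bsub>L\<^esub> y = y" "y \<squnion>\<^bsub>L\<^esub> z = z" "x \<in> carrier L" "y \<in> carrier L" "z \<in> carrier L" for x y z
    using L(3) that by metis
  \<comment> \<open>Weak associativity with \<open>x \<squnion> y\<close> in the place of
    \<open>z\<close>.\<close>
  have upper: "x \<squnion>\<^bsub>L\<^esub> (x \<squnion>\<^bsub>L\<^esub> y) = x \<squnion>\<^bsub>L\<^esub> y" if "x \<in> carrier L" "y \<in> carrier L" for x y
    using L(3) closed(1) refl that by metis
  have "partial_order ?P"
  proof unfold_locales
    fix x y
    assume "x \<sqsubseteq>\<^bsub>?P\<^esub> y" "y \<sqsubseteq>\<^bsub>?P\<^esub> x" "x \<in> carrier ?P" "y \<in> carrier ?P"
    then show "x .=\<^bsub>?P\<^esub> y"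
      using L(1)[of x y] by (simp add: induced_poset_def)
  qed (auto simp: induced_poset_def refl intro: trans)
  moreover from this have "bounded_uposet ?P"
    using closed assms L(1,6,7)
    by (auto simp: bounded_uposet_def induced_poset_def least_def greatest_def
        bounded_lambda_lattice_def algebra_def)
  moreover have "x \<squnion>\<^bsub>L\<^esub> y \<in> Upper ?P {x, y}" "x \<sqinter>\<^bsub>L\<^esub> y \<in> Lower ?P {x, y}"
    if "x \<in> carrier L" "y \<in> carrier L" for x y
  proof -
    have "y \<squnion>\<^bsub>L\<^esub> (x \<squnion>\<^bsub>L\<^esub> y) = x \<squnion>\<^bsub>L\<^esub> y"
      using that L(1) upper by metis
    then show "x \<squnion>\<^bsub>L\<^esub> y \<in> Upper ?P {x, y}"
      using that upper closed(1) by (auto simp: Upper_def induced_poset_def)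
    have "(x \<sqinter>\<^bsub>L\<^esub> y) \<squnion>\<^bsub>L\<^esub> x = x" "(x \<sqinter>\<^bsub>L\<^esub> y) \<squnion>\<^bsub>L\<^esub> y = y"
      using that L(1,2,4) closed(2) by metis+
    then show "x \<sqinter>\<^bsub>L\<^esub> y \<in> Lower ?P {x, y}"
      using that closed(2) by (auto simp: Lower_def induced_poset_def)
  qed
  \<comment> \<open>Writing \<open>y\<close> as \<open>x \<squnion> y\<close> makes this the
    absorption law.\<close>
  moreover have "x \<sqinter>\<^bsub>L\<^esub> y = x" "y \<sqinter>\<^bsub>L\<^esub> x = x"
    if "x \<in> carrier L" "y \<in> carrier L" "x \<squnion>\<^bsub>L\<^esub> y = y" for x y
    using that L(2,5) by metis+
  ultimately show ?thesis
    unfolding uposet_operations_def uposet_operations_axioms_def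
    by (simp add: induced_poset_def)
qed

section \<open>The variety and the main equivalence\<close>

lemma La_eq_equational_class:
  "La = equational_class (lambda_identities \<union>
     {join_compl_identity, meet_compl_identity, orthogonality_identity, asom_identity})"
proof -
  have "L \<in> La \<longleftrightarrow> bounded_lambda_lattice L \<and>
      (\<forall>e\<in>{join_compl_identity, meet_compl_identity, orthogonality_identity, asom_identity}.
         satisfies L e)" for L :: "'a ualg"
    using uposet_operations.agrees_almost_skew_orthomodular_iff_identities
        [OF uposet_operations_induced_poset, of L]
    unfolding La_def by blast
  then show ?thesis
    unfolding equational_class_def bounded_lambda_lattice_iff_identities ball_Un by blast
qed

theorem theorem5:
  shows "(\<forall>(P :: 'a uposet) (L :: 'a ualg). orthogonal_poset P \<and> assigned_to L P \<longrightarrow>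
            (almost_skew_orthomodular P \<longleftrightarrow> satisfies L asom_identity)) \<and>
         (\<exists>E. (La :: 'a ualg set) = equational_class E \<and> (La :: 'b ualg set) = equational_class E)"
proof (intro conjI allI impI)
  fix P :: "'a uposet" and L :: "'a ualg"
  assume "orthogonal_poset P \<and> assigned_to L P"
  then have *: "orthogonal_poset P" "assigned_to L P" "bounded_uposet P"
    by (auto simp: orthogonal_poset_def complemented_poset_def)
  interpret uposet_operations P L
    using *(2,3) by (rule uposet_operations_if_assigned)
  show "almost_skew_orthomodular P \<longleftrightarrow> satisfies L asom_identity"
    using *(1) agrees_with_poset_if_assigned[OF *(2,3)]
    by (rule almost_skew_orthomodular_iff_satisfies)
next
  show "\<exists>E. (La :: 'a ualg set) = equational_class E \<and> (La :: 'b ualg set) = equational_class E"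
    \<comment> \<open>The first conjunct determines \<open>E\<close>; as identities do not mention
      the element type, the same set serves for the second.\<close>
    by (intro exI conjI) (rule La_eq_equational_class)+
qed

end
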